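(* The $B$-value of the white 3-clique in $\bigtriangleup_{d}$ that corresponds to $\tau=(r,s,t)\in\bigtriangleup_{d-2}$ (i.e. the white 3-clique with locations $(r,s+1,t+1),(r+1,s,t+1),(r+1,s+1,t)$) is \begin{equation*} \frac{\det(T[\mu+\alpha])\det(T[\mu+\beta])\det(T[\mu+\gamma])}{\det(T[\mu-\alpha])\det(T[\mu-\beta])\det(T[\mu-\gamma])}, \end{equation*} where $\mu=(r+1,s,t+1)$ and we interpret $\det(\emptyset)=1$.
   Context: Fix an integer $d\ge 2$, a field $\mathbb{F}$, and a vector space $V$ over $\mathbb{F}$ of dimension $d+1$. Let $\bigtriangleup_{d}=\{(r,s,t)\in\mathbb{N}^3 : r+s+t=d\}$ (locations). Two locations are adjacent if their difference lies in $\{\pm\alpha,\pm\beta,\pm\gamma\}$, where $\alpha=e_1-e_2$, $\beta=e_2-e_3$, $\gamma=e_3-e_1$ in $\mathbb{R}^3$. A black 3-clique is a set $\{(r+1,s,t),(r,s+1,t),(r,s,t+1)\}$ with $(r,s,t)\in\bigtriangleup_{d-1}$; a white 3-clique is a set $\{(r,s+1,t+1),(r+1,s,t+1),(r+1,s+1,t)\}$ with $(r,s,t)\in\bigtriangleup_{d-2}$. For a matrix $A\in{\rm Mat}_{d+1}(\mathbb{F})$ (rows/columns indexed $0,\dots,d$) and $0\le i\le j\le d$, let $A[i,j]$ denote the submatrix $\{A_{kl}\}_{0\le k\le j-i,\ i\le l\le j}$. Let $T\in{\rm Mat}_{d+1}(\mathbb{F})$ be upper triangular with $T[i,j]$ invertible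 for all $0\le i\le j\le d$ ("very good"). View $T$ as the transition matrix from a basis $\{u_i\}_{i=0}^d$ of $V$ to a basis $\{v_i\}_{i=0}^d$, i.e. $v_j=\sum_i T_{ij}u_i$. Define flags $U_i=\mathbb{F}u_0+\cdots+\mathbb{F}u_i$, $U'_i=\mathbb{F}u_d+\cdots+\mathbb{F}u_{d-i}$, $U''_i=\mathbb{F}v_d+\cdots+\mathbb{F}v_{d-i}$ $(0\le i\le d)$; they are totally opposite, and $B_\lambda=U_{d-r}\cap U'_{d-s}\cap U''_{d-t}$ for $\lambda=(r,s,t)\in\bigtriangleup_d$ defines a Billiard Array $B$ on $V$ (each $B_\lambda$ is 1-dimensional). For adjacent locations $\lambda,\lambda'$, let $\nu$ be the unique location such that $\lambda,\lambda',\nu$ form a black 3-clique, and define the linear bijection $\widetilde{B}_{\lambda,\lambda'}:B_\lambda\to B_{\lambda'}$ sending $x\mapsto y$ whenever $x\in B_\lambda$, $y\in B_{\lambda'}$ are nonzero with $x+y\in B_\nu$. For the white 3-clique corresponding to $\tau=(r,s,t)\in\bigtriangleup_{d-2}$, with $\mu=(r+1,s,t+1)$, its $B$-value (clockwise $B$-value) is the scalar $c$ such that $\widetilde{B}_{\mu+\beta,\mu-\alpha}\circ\widetilde{B}_{\mu,\mu+\beta}\circ\widetilde{B}_{\mu-\alpha,\mu}=c\cdot{\rm id}$ on $B_{\mu-\alpha}$ (here $\mu-\alpha=(r,s+1,t+1)$, $\mu+\beta=(r+1,s+1,t)$). For $\lambda=(r',s',t')\in\mathbb{Z}^3$, define $T[\lambda]=T[t',d-r']$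 if $\lambda\in\bigtriangleup_d$, and $T[\lambda]=\emptyset$ otherwise. *)

theory Defs
  imports
    "HOL.Vector_Spaces"
    "HOL-Library.FuncSet"
    "HOL-Library.Product_Plus"
    "Jordan_Normal_Form.Determinant"
    "Jordan_Normal_Form.DL_Submatrix"
begin

(* Locations live in the lattice of integer triples, because the statement also refers to
   neighbours of a location that may leave the triangle. *)
type_synonym loc = "int \<times> int \<times> int"

definition triangle :: "nat \<Rightarrow> loc set" where
  "triangle d = {(r, s, t). 0 \<le> r \<and> 0 \<le> s \<and> 0 \<le> t \<and> r + s + t = int d}"

definition alpha :: loc where "alpha = (1, -1, 0)"
definition beta :: loc where "beta = (0, 1, -1)"
definition gamma :: loc where "gamma = (-1, 0, 1)"

definition black_clique :: "nat \<Rightarrow> loc set \<Rightarrow> bool" where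
  "black_clique d C \<longleftrightarrow>
     (\<exists>r s t. (r, s, t) \<in> triangle (d - 1) \<and> C = {(r + 1, s, t), (r, s + 1, t), (r, s, t + 1)})"

(* Well defined when the two given locations are adjacent. *)
definition completion :: "nat \<Rightarrow> loc \<Rightarrow> loc \<Rightarrow> loc" where
  "completion d l l' = (THE n. black_clique d {l, l', n})"


(* A[i,j]: the first j - i + 1 rows and the columns i, ..., j of A (not a principal submatrix). *)
definition sub_block :: "'a mat \<Rightarrow> nat \<Rightarrow> nat \<Rightarrow> 'a mat" where
  "sub_block A i j = submatrix A {0..j - i} {i..j}"

definition very_good :: "nat \<Rightarrow> 'a::field mat \<Rightarrow> bool" where
  "very_good d T \<longleftrightarrow> T \<in> carrier_mat (d + 1) (d + 1) \<and> upper_triangular T \<and>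
     (\<forall>i j. i \<le> j \<and> j \<le> d \<longrightarrow> invertible_mat (sub_block T i j))"

(* The empty matrix, used outside the triangle, has determinant 1 (det_dim_zero). *)
fun loc_block :: "nat \<Rightarrow> 'a::field mat \<Rightarrow> loc \<Rightarrow> 'a mat" where
  "loc_block d T (r, s, t) =
     (if (r, s, t) \<in> triangle d then sub_block T (nat t) (d - nat r) else 1\<^sub>m 0)"


definition indexed_basis ::
  "('a::field \<Rightarrow> 'b::ab_group_add \<Rightarrow> 'b) \<Rightarrow> nat \<Rightarrow> (nat \<Rightarrow> 'b) \<Rightarrow> bool" where
  "indexed_basis scale d u \<longleftrightarrow> inj_on u {0..d} \<and>
     \<not> Modules.module.dependent scale (u ` {0..d}) \<and> Modules.module.span scale (u ` {0..d}) = UNIV"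

definition transition_matrix ::
  "('a::field \<Rightarrow> 'b::ab_group_add \<Rightarrow> 'b) \<Rightarrow> nat \<Rightarrow> 'a mat \<Rightarrow> (nat \<Rightarrow> 'b) \<Rightarrow> (nat \<Rightarrow> 'b) \<Rightarrow> bool" where
  "transition_matrix scale d T u v \<longleftrightarrow> indexed_basis scale d u \<and> indexed_basis scale d v \<and>
     (\<forall>j\<le>d. v j = (\<Sum>i = 0..d. scale (T $$ (i, j)) (u i)))"

definition flag_up ::
  "('a::field \<Rightarrow> 'b::ab_group_add \<Rightarrow> 'b) \<Rightarrow> (nat \<Rightarrow> 'b) \<Rightarrow> nat \<Rightarrow> 'b set" where
  "flag_up scale u i = Modules.module.span scale (u ` {0..i})"

definition flag_down ::
  "('a::field \<Rightarrow> 'b::ab_group_add \<Rightarrow> 'b) \<Rightarrow> nat \<Rightarrow> (nat \<Rightarrow> 'b) \<Rightarrow> nat \<Rightarrow> 'b set" where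
  "flag_down scale d u i = Modules.module.span scale (u ` {d - i..d})"

(* Meaningful only at locations in triangle d. *)
fun array_of ::
  "('a::field \<Rightarrow> 'b::ab_group_add \<Rightarrow> 'b) \<Rightarrow> nat \<Rightarrow> (nat \<Rightarrow> 'b) \<Rightarrow> (nat \<Rightarrow> 'b) \<Rightarrow> loc \<Rightarrow> 'b set" where
  "array_of scale d u v (r, s, t) =
     flag_up scale u (d - nat r) \<inter> flag_down scale d u (d - nat s) \<inter> flag_down scale d v (d - nat t)"

(* Extensionality makes this map on the subspace B l unique as a total function. *)
definition transfer ::
  "('a::field \<Rightarrow> 'b::ab_group_add \<Rightarrow> 'b) \<Rightarrow> nat \<Rightarrow> (loc \<Rightarrow> 'b set) \<Rightarrow> loc \<Rightarrow> loc \<Rightarrow> 'b \<Rightarrow> 'b" where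
  "transfer scale d B l l' = (THE f. f \<in> extensional (B l) \<and> bij_betw f (B l) (B l') \<and>
     (\<forall>x\<in>B l. \<forall>y\<in>B l. f (x + y) = f x + f y) \<and>
     (\<forall>a. \<forall>x\<in>B l. f (scale a x) = scale a (f x)) \<and>
     (\<forall>x\<in>B l. \<forall>y\<in>B l'. x \<noteq> 0 \<and> y \<noteq> 0 \<and> x + y \<in> B (completion d l l') \<longrightarrow> f x = y))"

(* The clockwise value of the white 3-clique
   {(r, s + 1, t + 1), (r + 1, s, t + 1), (r + 1, s + 1, t)}, which is indexed by (r, s, t). *)
fun B_value ::
  "('a::field \<Rightarrow> 'b::ab_group_add \<Rightarrow> 'b) \<Rightarrow> nat \<Rightarrow> (loc \<Rightarrow> 'b set) \<Rightarrow> loc \<Rightarrow> 'a" where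
  "B_value scale d B (r, s, t) = (let m = (r + 1, s, t + 1) in
     THE c. \<forall>x\<in>B (m - alpha).
       (transfer scale d B (m + beta) (m - alpha) \<circ> transfer scale d B m (m + beta)
         \<circ> transfer scale d B (m - alpha) m) x = scale c x)"

end

theory Submission
  imports Defs
begin

text \<open>
  On the line \<open>B (r, s, t)\<close> a vector is determined by its \<open>u s\<close>-coordinate, and Cramer's rule for the
  block \<open>T[t, d - r]\<close> yields a spanning vector whose \<open>u s\<close>-coordinate is \<open>det T[t, d - r]\<close> and whose
  extreme \<open>v\<close>-coordinates are \<open>(-1)^s det T[t + 1, d - r]\<close> and \<open>det T[t, d - r - 1]\<close>. In a black 3-clique
  each line is the kernel of one of the coordinate functionals \<open>v t\<close>, \<open>u s\<close>, \<open>v (d - r)\<close> on the plane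
  spanned by the clique, so the transfer between the two other lines multiplies spanning vectors by
  minus the quotient of the values of that functional. The product of three such quotients around a
  white 3-clique telescopes to the stated ratio.
\<close>

subsection \<open>Blocks of the transition matrix\<close>

text \<open>Start column and size as parameters admit the empty block \<open>n = 0\<close>, of
  determinant 1, which two first and last column indices \<open>i \<le> j\<close> cannot
  express.\<close>

definition block :: "'a mat \<Rightarrow> nat \<Rightarrow> nat \<Rightarrow> 'a mat" where
  "block A i n = mat n n (\<lambda>(k, l). A $$ (k, i + l))"

lemma block_carrier [simp]: "block A i n \<in> carrier_mat n n"
  by (simp add: block_def)

lemma block_index: "k < n \<Longrightarrow> l < n \<Longrightarrow> block A i n $$ (k, l) = A $$ (k, i + l)"
  by (simp add: block_def)

lemma sub_block_eq_block:
  assumes "A \<in> carrier_mat (d + 1) (d + 1)" "i \<le> j" "j \<le> d"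
  shows "sub_block A i j = block A i (j - i + 1)"
proof (rule eq_matI)
  have "{k. k < dim_row A \<and> k \<in> {0..j - i}} = {0..j - i}"
    and "{k. k < dim_col A \<and> k \<in> {i..j}} = {i..j}"
    using assms by auto
  then show "dim_row (sub_block A i j) = dim_row (block A i (j - i + 1))"
    and "dim_col (sub_block A i j) = dim_col (block A i (j - i + 1))"
    using assms by (auto simp: sub_block_def dim_submatrix block_def)
  fix k l assume "k < dim_row (block A i (j - i + 1))" "l < dim_col (block A i (j - i + 1))"
  then have kl: "k \<le> j - i" "l \<le> j - i"
    by (auto simp: block_def)
  \<comment> \<open>\<open>submatrix_index_card\<close> addresses an entry by the number of selected
    indices below it; here these counts are \<open>k\<close> and \<open>l\<close>.\<close>
  have "{a \<in> {0..j - i}. a < k} = {0..<k}" "{a \<in> {i..j}. a < i + l} = {i..<i + l}"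
    using kl by auto
  then have "submatrix A {0..j - i} {i..j} $$ (k, l) = A $$ (k, i + l)"
    using submatrix_index_card[of k A "i + l" "{0..j - i}" "{i..j}"] kl assms by auto
  then show "sub_block A i j $$ (k, l) = block A i (j - i + 1) $$ (k, l)"
    using kl by (simp add: sub_block_def block_index)
qed

lemma invertible_mat_det_nonzero:
  fixes A :: "'a::field mat"
  assumes "A \<in> carrier_mat n n" "invertible_mat A"
  shows "det A \<noteq> 0"
proof -
  obtain B where AB: "A * B = 1\<^sub>m (dim_row A)" and BA: "B * A = 1\<^sub>m (dim_row B)"
    using assms(2) unfolding invertible_mat_def inverts_mat_def by blast
  \<comment> \<open>Invertibility alone does not state the shape of \<open>B\<close>; the column
    counts of the two products force it to be square.\<close>
  have "dim_col B = n"
    using arg_cong[OF AB, of dim_col] assms(1) by simp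
  moreover have "dim_row B = n"
    using arg_cong[OF BA, of dim_col] assms(1) by simp
  ultimately have "B \<in> carrier_mat n n"
    by auto
  then have "det A * det B = det (1\<^sub>m n)"
    using det_mult[OF assms(1)] AB assms(1) by (metis carrier_matD(1))
  then show ?thesis
    by auto
qed

lemma very_good_det_block:
  assumes "very_good d T" "i + n \<le> d + 1"
  shows "det (block T i n) \<noteq> 0"
proof (cases n)
  case 0
  then show ?thesis
    using det_dim_zero[of "block T i n"] block_carrier[of T i n] by simp
next
  case (Suc k)
  then have "sub_block T i (i + k) = block T i n"
    using sub_block_eq_block[of T d i "i + k"] assms by (simp add: very_good_def)
  moreover have "invertible_mat (sub_block T i (i + k))"
    using assms Suc by (simp add: very_good_def)
  ultimately show ?thesis
    using invertible_mat_det_nonzero[OF block_carrier] by metis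
qed

text \<open>The full block is \<open>T\<close> itself, and the determinant of a triangular matrix is
  the product of its diagonal.\<close>

lemma very_good_diag_nonzero:
  assumes "very_good d T" "i \<le> d"
  shows "T $$ (i, i) \<noteq> 0"
proof -
  have T: "T \<in> carrier_mat (d + 1) (d + 1)" "upper_triangular T"
    using assms by (auto simp: very_good_def)
  have "block T 0 (d + 1) = T"
    using T(1) by (intro eq_matI) (auto simp: block_def)
  then have "det T \<noteq> 0"
    using very_good_det_block[OF assms(1), of 0 "d + 1"] by simp
  then have "0 \<notin> set (diag_mat T)"
    using det_upper_triangular[OF T(2,1)] by (simp add: prod_list_zero_iff)
  then show ?thesis
    using T(1) assms(2) by (auto simp: diag_mat_def image_iff)
qed

text \<open>At \<open>s = -1\<close> the location lies outside the triangle and the block is empty.\<close>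

lemma det_loc_block:
  assumes "very_good d T" "0 \<le> r" "-1 \<le> s" "0 \<le> t" "r + s + t = int d"
  shows "det (loc_block d T (r, s, t)) = det (block T (nat t) (nat (s + 1)))"
proof (cases "s = -1")
  case True
  have "det (block T (nat t) 0) = 1"
    by (rule det_dim_zero) simp
  then show ?thesis
    using True by (simp add: triangle_def)
next
  case False
  then have s: "0 \<le> s"
    using assms by simp
  then have "sub_block T (nat t) (d - nat r) = block T (nat t) (d - nat r - nat t + 1)"
    using assms by (intro sub_block_eq_block[of _ d]) (auto simp: very_good_def)
  moreover have "d - nat r - nat t + 1 = nat (s + 1)"
    using assms s by linarith
  ultimately show ?thesis
    using assms s by (simp add: triangle_def)
qed

text \<open>This is entry \<open>(k, i)\<close> of the product of \<open>A\<close> with its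
  adjugate, which is \<open>det A\<close> times the identity.\<close>

lemma mult_cofactor_sum:
  fixes A :: "'a::comm_ring_1 mat"
  assumes "A \<in> carrier_mat n n" "k < n" "i < n"
  shows "(\<Sum>l<n. A $$ (k, l) * cofactor A i l) = (if k = i then det A else 0)"
proof -
  have "(\<Sum>l<n. A $$ (k, l) * cofactor A i l) = (A * adj_mat A) $$ (k, i)"
    using assms by (auto simp: adj_mat_def times_mat_def scalar_prod_def intro!: sum.cong)
  also have "\<dots> = (if k = i then det A else 0)"
    using adj_mat(2)[OF assms(1)] assms by simp
  finally show ?thesis .
qed

text \<open>Deleting the last row and the first column leaves a block that starts one column later,
  so an end cofactor is, up to sign, again a block determinant.\<close>

lemma cofactor_block_first:
  "cofactor (block A t (Suc s)) s 0 = (-1) ^ s * det (block A (t + 1) s)"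
proof -
  have "mat_delete (block A t (Suc s)) s 0 = block A (t + 1) s"
    by (rule eq_matI) (auto simp: mat_delete_def block_def)
  then show ?thesis
    by (simp add: cofactor_def)
qed

lemma cofactor_block_last:
  "cofactor (block A t (Suc s)) s s = det (block A t s)"
proof -
  have "mat_delete (block A t (Suc s)) s s = block A t s"
    by (rule eq_matI) (auto simp: mat_delete_def block_def)
  then show ?thesis
    by (simp add: cofactor_def)
qed

subsection \<open>Completion of black 3-cliques\<close>

text \<open>By the last hypothesis every black 3-clique through \<open>l\<close> and
  \<open>l'\<close> contains \<open>n\<close>; as \<open>n\<close> differs from both, a competing
  third vertex must be \<open>n\<close>.\<close>

lemma completion_eqI:
  assumes "black_clique d {l, l', n}" "n \<noteq> l" "n \<noteq> l'"
    and "\<And>r s t. l \<in> {(r + 1, s, t), (r, s + 1, t), (r, s, t + 1)} \<Longrightarrow>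
      l' \<in> {(r + 1, s, t), (r, s + 1, t), (r, s, t + 1)} \<Longrightarrow>
      n \<in> {(r + 1, s, t), (r, s + 1, t), (r, s, t + 1)}"
  shows "completion d l l' = n"
  unfolding completion_def
proof (rule the_equality)
  show "black_clique d {l, l', n}"
    by (rule assms(1))
  fix n' assume "black_clique d {l, l', n'}"
  then obtain r s t where C: "{l, l', n'} = {(r + 1, s, t), (r, s + 1, t), (r, s, t + 1)}"
    unfolding black_clique_def by blast
  have "n \<in> {l, l', n'}"
    unfolding C by (rule assms(4)) (simp_all add: C[symmetric])
  then show "n' = n"
    using assms(2,3) by simp
qed

text \<open>These are the three edge directions that the loop around a white 3-clique
  traverses.\<close>

lemma completion_clique:
  assumes "0 \<le> r" "0 \<le> s" "0 \<le> t" "r + s + t = int (d - 1)"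
  shows "completion d (r, s + 1, t) (r + 1, s, t) = (r, s, t + 1)"
    and "completion d (r + 1, s, t) (r, s, t + 1) = (r, s + 1, t)"
    and "completion d (r, s, t + 1) (r, s + 1, t) = (r + 1, s, t)"
proof -
  have clique: "black_clique d {(r + 1, s, t), (r, s + 1, t), (r, s, t + 1)}"
    unfolding black_clique_def using assms by (auto simp: triangle_def)
  show "completion d (r, s + 1, t) (r + 1, s, t) = (r, s, t + 1)"
    using clique by (intro completion_eqI) (auto simp: insert_commute)
  show "completion d (r + 1, s, t) (r, s, t + 1) = (r, s + 1, t)"
    using clique by (intro completion_eqI) (auto simp: insert_commute)
  show "completion d (r, s, t + 1) (r, s + 1, t) = (r + 1, s, t)"
    using clique by (intro completion_eqI) (auto simp: insert_commute)
qed

subsection \<open>Coordinates with respect to an indexed basis\<close>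

text \<open>\<open>representation\<close> is indexed by basis vectors, whereas the flags and the
  matrix refer to positions in the basis.\<close>

definition coord ::
  "('a::field \<Rightarrow> 'b::ab_group_add \<Rightarrow> 'b) \<Rightarrow> nat \<Rightarrow> (nat \<Rightarrow> 'b) \<Rightarrow> nat \<Rightarrow> 'b \<Rightarrow> 'a" where
  "coord scale d b i x = Modules.module.representation scale (b ` {0..d}) x (b i)"

context vector_space
begin

lemma coord_add:
  "indexed_basis scale d b \<Longrightarrow> coord scale d b i (x + y) = coord scale d b i x + coord scale d b i y"
  by (simp add: coord_def indexed_basis_def representation_add)

lemma coord_scale:
  "indexed_basis scale d b \<Longrightarrow> coord scale d b i (scale c x) = c * coord scale d b i x"
  by (simp add: coord_def indexed_basis_def representation_scale)

lemma coord_sum: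
  "indexed_basis scale d b \<Longrightarrow> coord scale d b i (\<Sum>j\<in>J. f j) = (\<Sum>j\<in>J. coord scale d b i (f j))"
  by (simp add: coord_def indexed_basis_def representation_sum)

lemma coord_basis:
  assumes "indexed_basis scale d b" "i \<le> d" "j \<le> d"
  shows "coord scale d b i (b j) = (if i = j then 1 else 0)"
  using assms by (auto simp: coord_def indexed_basis_def representation_basis inj_on_eq_iff)

lemma coord_expansion:
  assumes "indexed_basis scale d b"
  shows "(\<Sum>i = 0..d. scale (coord scale d b i x) (b i)) = x"
proof -
  have "(\<Sum>y\<in>b ` {0..d}. scale (representation (b ` {0..d}) x y) y) = x"
    using assms by (intro sum_representation_eq) (auto simp: indexed_basis_def)
  then show ?thesis
    using assms by (simp add: sum.reindex indexed_basis_def coord_def)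
qed

lemma coord_combination:
  assumes "indexed_basis scale d b" "i \<le> d"
  shows "coord scale d b i (\<Sum>j = 0..d. scale (c j) (b j)) = c i"
proof -
  have "coord scale d b i (\<Sum>j = 0..d. scale (c j) (b j)) = (\<Sum>j = 0..d. if i = j then c j else 0)"
    unfolding coord_sum[OF assms(1)]
    using assms by (intro sum.cong) (auto simp: coord_scale coord_basis)
  then show ?thesis
    using assms(2) by simp
qed

lemma coord_eq_zero_imp:
  assumes "indexed_basis scale d b" "\<And>i. i \<le> d \<Longrightarrow> coord scale d b i x = 0"
  shows "x = 0"
  using coord_expansion[OF assms(1), of x] assms(2) by simp

text \<open>Flags are spans of consecutive basis vectors, so this turns membership in them into
  vanishing of coordinates.\<close>

lemma mem_span_iff_coord:
  assumes "indexed_basis scale d b" "I \<subseteq> {0..d}"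
  shows "x \<in> span (b ` I) \<longleftrightarrow> (\<forall>i\<le>d. i \<notin> I \<longrightarrow> coord scale d b i x = 0)"
proof
  show "x \<in> span (b ` I) \<Longrightarrow> \<forall>i\<le>d. i \<notin> I \<longrightarrow> coord scale d b i x = 0"
  proof (induction rule: span_induct_alt)
    case base
    show ?case
      using coord_scale[OF assms(1), of _ 0 0] by simp
  next
    case (step c y z)
    then obtain j where "j \<in> I" "y = b j"
      by auto
    moreover have "j \<le> d"
      using assms(2) \<open>j \<in> I\<close> by auto
    ultimately have "coord scale d b i y = 0" if "i \<le> d" "i \<notin> I" for i
      using that assms(1) by (auto simp: coord_basis)
    then show ?case
      using step.IH assms(1) by (simp add: coord_add coord_scale)
  qed
next
  assume zero: "\<forall>i\<le>d. i \<notin> I \<longrightarrow> coord scale d b i x = 0"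
  have "x = (\<Sum>i\<in>{0..d}. scale (coord scale d b i x) (b i))"
    using coord_expansion[OF assms(1)] by simp
  also have "\<dots> = (\<Sum>i\<in>I. scale (coord scale d b i x) (b i))"
    using assms(2) zero by (intro sum.mono_neutral_right) auto
  also have "\<dots> \<in> span (b ` I)"
    by (intro span_sum span_scale span_base) auto
  finally show "x \<in> span (b ` I)" .
qed

subsection \<open>Transfer maps between lines\<close>

text \<open>Since \<open>f\<close> vanishes on the third line, \<open>z + w\<close> can lie there
  only if \<open>f w = - f z\<close>, which fixes \<open>w\<close> as a multiple of
  \<open>y\<close>. The pair in \<open>compl\<close> then determines the whole linear map.\<close>

lemma transfer_scale:
  assumes Bl: "B l = range (\<lambda>c. scale c x)" and Bl': "B l' = range (\<lambda>c. scale c y)"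
    and add: "\<And>z w. f (z + w) = f z + f w" and hom: "\<And>c z. f (scale c z) = c * f z"
    and fx: "f x \<noteq> 0" and fy: "f y \<noteq> 0"
    and kernel: "\<And>z. z \<in> B (completion d l l') \<Longrightarrow> f z = 0"
    and compl: "x + scale (- (f x / f y)) y \<in> B (completion d l l')"
  shows "transfer scale d B l l' (scale c x) = scale (c * - (f x / f y)) y"
proof -
  let ?k = "- (f x / f y)"
  \<comment> \<open>The coefficient is the only one that makes the \<open>f\<close>-values of
    \<open>z\<close> and its image cancel; restriction supplies extensionality.\<close>
  define F where "F = restrict (\<lambda>z. scale (- (f z / f y)) y) (B l)"
  have inB: "scale c x \<in> B l" for c
    using Bl by auto
  have x: "x \<in> B l"
    using inB[of 1] by simp
  have zeros: "x \<noteq> 0" "y \<noteq> 0"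
    using hom[of 0 0] fx fy by auto
  have F: "F (scale c x) = scale (c * ?k) y" for c
    using inB[of c] by (simp add: F_def hom)
  have closed: "z + w \<in> B l" "scale a z \<in> B l" if zw: "z \<in> B l" "w \<in> B l" for z w a
  proof -
    obtain p q where "z = scale p x" "w = scale q x"
      using zw Bl by auto
    then show "z + w \<in> B l" "scale a z \<in> B l"
      using inB[of "p + q"] inB[of "a * p"] by (auto simp: scale_left_distrib)
  qed
  have bij: "bij_betw F (B l) (B l')"
  proof (rule bij_betw_imageI)
    show "inj_on F (B l)"
      using zeros fx fy by (auto simp: inj_on_def Bl F)
    have "scale q y = F (scale (q / ?k) x)" for q
      using F[of "q / ?k"] fx fy by simp
    then have "scale q y \<in> F ` B l" for q
      using inB by blast
    moreover have "F (scale c x) \<in> B l'" for c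
      unfolding F Bl' by (rule rangeI)
    then have "F ` B l \<subseteq> B l'"
      unfolding Bl by blast
    ultimately show "F ` B l = B l'"
      unfolding Bl' by blast
  qed
  have compl_F: "F z = w" if zw: "z \<in> B l" "w \<in> B l'" "z + w \<in> B (completion d l l')" for z w
  proof -
    obtain q where w: "w = scale q y"
      using zw(2) Bl' by auto
    have "f z = - (q * f y)"
      using kernel[OF zw(3)] w by (simp add: add hom eq_neg_iff_add_eq_0)
    then show ?thesis
      using zw(1) w fy by (simp add: F_def)
  qed
  have add_F: "F (z + w) = F z + F w" if "z \<in> B l" "w \<in> B l" for z w
  proof -
    have "- (f (z + w) / f y) = - (f z / f y) + - (f w / f y)"
      by (simp add: add add_divide_distrib)
    then show ?thesis
      using that closed(1)[OF that] unfolding F_def by (simp only: restrict_apply if_True scale_left_distrib)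
  qed
  have hom_F: "F (scale a z) = scale a (F z)" if "z \<in> B l" for a z
    using that closed(2)[OF that that] by (simp add: F_def hom)
  have ext_F: "F \<in> extensional (B l)"
    by (simp add: F_def)
  have unique: "g = F"
    if g: "g \<in> extensional (B l)" "\<forall>a. \<forall>z\<in>B l. g (scale a z) = scale a (g z)"
      "\<forall>z\<in>B l. \<forall>w\<in>B l'. z \<noteq> 0 \<and> w \<noteq> 0 \<and> z + w \<in> B (completion d l l') \<longrightarrow> g z = w" for g
  proof (rule extensionalityI[OF g(1)])
    \<comment> \<open>A competing map is pinned down at \<open>x\<close> by the nonzero pair
      \<open>x\<close>, \<open>scale ?k y\<close>, and homogeneity carries this to the whole
      line.\<close>
    have "scale ?k y \<in> B l'" "scale ?k y \<noteq> 0"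
      unfolding Bl' using zeros fx fy by (blast, simp)
    then have "g x = scale ?k y"
      using g(3) x zeros compl by blast
    then have gF: "g (scale c x) = F (scale c x)" for c
      using g(2) x F[of c] by simp
    show "F \<in> extensional (B l)"
      by (simp add: F_def)
    show "g z = F z" if "z \<in> B l" for z
      using that gF unfolding Bl by auto
  qed
  have "transfer scale d B l l' = F"
    unfolding transfer_def
  proof (rule the_equality)
    fix g
    assume "g \<in> extensional (B l) \<and> bij_betw g (B l) (B l') \<and>
      (\<forall>z\<in>B l. \<forall>w\<in>B l. g (z + w) = g z + g w) \<and>
      (\<forall>a. \<forall>z\<in>B l. g (scale a z) = scale a (g z)) \<and>
      (\<forall>z\<in>B l. \<forall>w\<in>B l'. z \<noteq> 0 \<and> w \<noteq> 0 \<and> z + w \<in> B (completion d l l') \<longrightarrow> g z = w)"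
    then show "g = F"
      by (elim conjE) (rule unique)
  qed (intro conjI ballI allI impI; (elim conjE)?, (rule bij compl_F add_F hom_F ext_F; assumption?)+)
  then show ?thesis
    using F by simp
qed

end

subsection \<open>The array of a very good transition matrix\<close>

locale very_good_transition = vector_space scale
  for scale :: "'a::field \<Rightarrow> 'b::ab_group_add \<Rightarrow> 'b" +
  fixes d :: nat and T :: "'a mat" and u v :: "nat \<Rightarrow> 'b"
  assumes very_good: "very_good d T" and transition: "transition_matrix scale d T u v"
begin

abbreviation "uc \<equiv> coord scale d u"
abbreviation "vc \<equiv> coord scale d v"

lemma basis_u: "indexed_basis scale d u" and basis_v: "indexed_basis scale d v"
  using transition by (auto simp: transition_matrix_def)

lemmas coord_simps =
  coord_add[OF basis_u] coord_add[OF basis_v] coord_scale[OF basis_u] coord_scale[OF basis_v]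

lemma T_lower_zero: "j < i \<Longrightarrow> i \<le> d \<Longrightarrow> T $$ (i, j) = 0"
  using very_good by (auto simp: very_good_def)

section \<open>Change of coordinates between the two bases\<close>

lemma uc_eq_sum_vc:
  assumes "i \<le> d"
  shows "uc i x = (\<Sum>j = 0..d. T $$ (i, j) * vc j x)"
proof -
  have "uc i (v j) = T $$ (i, j)" if "j \<le> d" for j
    using transition that coord_combination[OF basis_u assms] by (simp add: transition_matrix_def)
  moreover have "uc i x = (\<Sum>j = 0..d. vc j x * uc i (v j))"
    by (subst coord_expansion[OF basis_v, of x, symmetric])
      (simp add: coord_sum[OF basis_u] coord_scale[OF basis_u])
  ultimately show ?thesis
    by (simp add: mult.commute)
qed

text \<open>As \<open>T\<close> is upper triangular with nonzero diagonal, initial segments of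
  \<open>u\<close> and \<open>v\<close> span the same subspaces; the first flag can thus be read off
  \<open>v\<close>-coordinates.\<close>

lemma vc_upper_zero_iff:
  "(\<forall>j\<le>d. k < j \<longrightarrow> uc j x = 0) \<longleftrightarrow> (\<forall>j\<le>d. k < j \<longrightarrow> vc j x = 0)"
proof
  assume v: "\<forall>j\<le>d. k < j \<longrightarrow> vc j x = 0"
  have "T $$ (i, j) * vc j x = 0" if "k < i" "i \<le> d" "j \<le> d" for i j
    using v that T_lower_zero[of j i] by (cases "j < i") auto
  then show "\<forall>j\<le>d. k < j \<longrightarrow> uc j x = 0"
    by (auto simp: uc_eq_sum_vc intro!: sum.neutral)
next
  assume u: "\<forall>j\<le>d. k < j \<longrightarrow> uc j x = 0"
  \<comment> \<open>Back substitution from \<open>j = d\<close> downwards: triangularity removes the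
    columns before \<open>j\<close>, induction those after it, and the diagonal term
    remains.\<close>
  have "j \<le> d \<longrightarrow> k < j \<longrightarrow> vc j x = 0" for j
  proof (induction "d - j" arbitrary: j rule: less_induct)
    case less
    show ?case
    proof (intro impI)
      assume j: "j \<le> d" "k < j"
      have "T $$ (j, l) * vc l x = 0" if "l \<le> d" "l \<noteq> j" for l
        using less.hyps[of l] that j T_lower_zero[of l j] by (cases "l < j") auto
      then have "uc j x = (\<Sum>l = 0..d. if l = j then T $$ (j, j) * vc j x else 0)"
        unfolding uc_eq_sum_vc[OF j(1)] by (intro sum.cong) auto
      then have "T $$ (j, j) * vc j x = 0"
        using u j by simp
      then show "vc j x = 0"
        using very_good_diag_nonzero[OF very_good j(1)] by simp
    qed
  qed
  then show "\<forall>j\<le>d. k < j \<longrightarrow> vc j x = 0"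
    by blast
qed

text \<open>For \<open>r + s + t = d - 1\<close> this is the plane spanned by a black 3-clique.\<close>

definition cell :: "nat \<Rightarrow> nat \<Rightarrow> nat \<Rightarrow> 'b set" where
  "cell r s t =
     {x. (\<forall>j\<le>d. d - r < j \<longrightarrow> vc j x = 0) \<and> (\<forall>j<t. vc j x = 0) \<and> (\<forall>i<s. uc i x = 0)}"

lemma array_of_eq_cell:
  assumes "0 \<le> r" "0 \<le> s" "0 \<le> t" "r + s + t = int d"
  shows "array_of scale d u v (r, s, t) = cell (nat r) (nat s) (nat t)"
proof -
  have le: "nat r \<le> d" "nat s \<le> d" "nat t \<le> d"
    using assms by auto
  have "x \<in> flag_up scale u (d - nat r) \<longleftrightarrow> (\<forall>j\<le>d. d - nat r < j \<longrightarrow> vc j x = 0)" for x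
    unfolding flag_up_def vc_upper_zero_iff[symmetric]
    by (subst mem_span_iff_coord[OF basis_u]) (auto simp: not_le)
  \<comment> \<open>Because \<open>nat s \<le> d\<close>, the truncated difference
    \<open>d - (d - nat s)\<close> is \<open>nat s\<close>, where the span starts.\<close>
  moreover have "x \<in> flag_down scale d u (d - nat s) \<longleftrightarrow> (\<forall>i<nat s. uc i x = 0)" for x
    unfolding flag_down_def using le(2)
    by (subst mem_span_iff_coord[OF basis_u]) (auto simp: not_le)
  moreover have "x \<in> flag_down scale d v (d - nat t) \<longleftrightarrow> (\<forall>j<nat t. vc j x = 0)" for x
    unfolding flag_down_def using le(3)
    by (subst mem_span_iff_coord[OF basis_v]) (auto simp: not_le)
  ultimately show ?thesis
    unfolding cell_def by auto
qed

text \<open>The \<open>v\<close>-coordinates of \<open>x\<close> live on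
  \<open>t, ..., d - r = t + s\<close>, exactly the columns of the block.\<close>

lemma uc_eq_block_sum:
  assumes "r + s + t = d" "k \<le> s" "\<And>j. j \<le> d \<Longrightarrow> d - r < j \<Longrightarrow> vc j x = 0" "\<And>j. j < t \<Longrightarrow> vc j x = 0"
  shows "uc k x = (\<Sum>l<Suc s. block T t (Suc s) $$ (k, l) * vc (t + l) x)"
proof -
  have "uc k x = (\<Sum>j = 0..d. T $$ (k, j) * vc j x)"
    using assms by (intro uc_eq_sum_vc) simp
  also have "\<dots> = (\<Sum>j\<in>(+) t ` {..<Suc s}. T $$ (k, j) * vc j x)"
  proof (rule sum.mono_neutral_right)
    show "\<forall>j\<in>{0..d} - (+) t ` {..<Suc s}. T $$ (k, j) * vc j x = 0"
    proof
      fix j assume j: "j \<in> {0..d} - (+) t ` {..<Suc s}"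
      have "j < t \<or> d - r < j"
      proof (rule ccontr)
        assume "\<not> (j < t \<or> d - r < j)"
        then have "j = t + (j - t)" "j - t \<in> {..<Suc s}"
          using assms(1) by auto
        then show False
          using j by blast
      qed
      then show "T $$ (k, j) * vc j x = 0"
        using assms(3,4) j by auto
    qed
  qed (use assms(1) in auto)
  also have "\<dots> = (\<Sum>l<Suc s. block T t (Suc s) $$ (k, l) * vc (t + l) x)"
    using assms(2) by (simp add: sum.reindex block_index del: sum.lessThan_Suc)
  finally show ?thesis .
qed

text \<open>The \<open>u\<close>-coordinates \<open>0, ..., s\<close> all vanish, so the remaining
  \<open>v\<close>-coordinates solve a homogeneous system whose matrix is an invertible
  block.\<close>

lemma cell_eq_zeroI:
  assumes "r + s + t = d" "x \<in> cell r s t" "uc s x = 0"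
  shows "x = 0"
proof (rule coord_eq_zero_imp[OF basis_v])
  let ?A = "block T t (Suc s)" and ?y = "vec (Suc s) (\<lambda>l. vc (t + l) x)"
  have x: "\<And>j. j \<le> d \<Longrightarrow> d - r < j \<Longrightarrow> vc j x = 0" "\<And>j. j < t \<Longrightarrow> vc j x = 0" "\<And>i. i < s \<Longrightarrow> uc i x = 0"
    using assms(2) by (auto simp: cell_def)
  have "?A *\<^sub>v ?y = 0\<^sub>v (Suc s)"
  proof (rule eq_vecI)
    fix k assume "k < dim_vec (0\<^sub>v (Suc s))"
    then have k: "k \<le> s"
      by simp
    have "(?A *\<^sub>v ?y) $ k = (\<Sum>l<Suc s. ?A $$ (k, l) * vc (t + l) x)"
      using k by (simp add: block_def scalar_prod_def atLeast0LessThan del: sum.lessThan_Suc)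
    also have "\<dots> = uc k x"
      by (rule uc_eq_block_sum[OF assms(1) k x(1,2), symmetric])
    also have "\<dots> = 0"
      using k x(3) assms(3) by (cases "k = s") auto
    finally show "(?A *\<^sub>v ?y) $ k = 0\<^sub>v (Suc s) $ k"
      using k by simp
  qed (simp add: block_def)
  moreover have "det ?A \<noteq> 0"
    using very_good_det_block[OF very_good] assms(1) by simp
  ultimately have y: "?y = 0\<^sub>v (Suc s)"
    using det_0_iff_vec_prod_zero_field[OF block_carrier, of T t "Suc s"] vec_carrier by blast
  fix j assume "j \<le> d"
  show "vc j x = 0"
  proof (cases "t \<le> j \<and> j \<le> d - r")
    case True
    then have "j - t < Suc s" "t + (j - t) = j"
      using assms(1) by auto
    then show ?thesis
      using arg_cong[OF y, of "\<lambda>z. z $ (j - t)"] by simp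
  next
    case False
    then show ?thesis
      using x \<open>j \<le> d\<close> by auto
  qed
qed

text \<open>The \<open>v\<close>-coordinates are those in the last column of the adjugate of \<open>T[t, t + s]\<close>.\<close>

definition cell_vector :: "nat \<Rightarrow> nat \<Rightarrow> 'b" where
  "cell_vector s t = (\<Sum>j = 0..d. scale
     (if t \<le> j \<and> j \<le> t + s then cofactor (block T t (Suc s)) s (j - t) else 0) (v j))"

lemma vc_cell_vector:
  "j \<le> d \<Longrightarrow> vc j (cell_vector s t) =
     (if t \<le> j \<and> j \<le> t + s then cofactor (block T t (Suc s)) s (j - t) else 0)"
  unfolding cell_vector_def by (rule coord_combination[OF basis_v])

lemma vc_first_cell_vector:
  "s + t \<le> d \<Longrightarrow> vc t (cell_vector s t) = (-1) ^ s * det (block T (t + 1) s)"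
  by (simp add: vc_cell_vector cofactor_block_first)

lemma vc_last_cell_vector:
  "s + t \<le> d \<Longrightarrow> vc (s + t) (cell_vector s t) = det (block T t s)"
  by (simp add: vc_cell_vector cofactor_block_last)

text \<open>Cramer's rule: the cofactors of the last row are orthogonal to all earlier rows and give
  the determinant against the last one.\<close>

lemma uc_cell_vector:
  assumes "s + t \<le> d" "k \<le> s"
  shows "uc k (cell_vector s t) = (if k = s then det (block T t (Suc s)) else 0)"
proof -
  let ?A = "block T t (Suc s)"
  have "uc k (cell_vector s t) = (\<Sum>l<Suc s. ?A $$ (k, l) * vc (t + l) (cell_vector s t))"
    using assms by (intro uc_eq_block_sum[of "d - s - t"]) (auto simp: vc_cell_vector)
  also have "\<dots> = (\<Sum>l<Suc s. ?A $$ (k, l) * cofactor ?A s l)"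
    using assms by (intro sum.cong) (auto simp: vc_cell_vector)
  also have "\<dots> = (if k = s then det ?A else 0)"
    using assms by (intro mult_cofactor_sum) auto
  finally show ?thesis .
qed

lemma cell_combination:
  assumes "x \<in> cell r s t" "y \<in> cell r s t"
  shows "x + scale c y \<in> cell r s t"
  using assms by (simp add: cell_def coord_simps)

text \<open>Subtracting the multiple of \<open>cell_vector s t\<close> with the same
  \<open>u s\<close>-coordinate leaves an element of the cell that \<open>cell_eq_zeroI\<close>
  shows to be zero.\<close>

lemma cell_eq_line:
  assumes "r + s + t = d"
  shows "cell r s t = range (\<lambda>c. scale c (cell_vector s t))"
proof
  let ?X = "cell_vector s t"
  have st: "s + t \<le> d" "d - r = s + t"
    using assms by auto
  have D: "uc s ?X \<noteq> 0"
    using uc_cell_vector[OF st(1)] very_good_det_block[OF very_good, of t "Suc s"] st by simp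
  have X: "scale c ?X \<in> cell r s t" for c
    using st by (auto simp: cell_def coord_simps vc_cell_vector uc_cell_vector)
  then show "range (\<lambda>c. scale c ?X) \<subseteq> cell r s t"
    by blast
  show "cell r s t \<subseteq> range (\<lambda>c. scale c ?X)"
  proof
    fix x assume x: "x \<in> cell r s t"
    define c where "c = uc s x / uc s ?X"
    have "x + scale (- c) ?X \<in> cell r s t"
      using cell_combination[OF x X[of 1], of "- c"] by simp
    moreover have "uc s (x + scale (- c) ?X) = 0"
      using D by (simp add: coord_simps c_def del: scale_minus_left)
    ultimately have "x + scale (- c) ?X = 0"
      using cell_eq_zeroI[OF assms] by blast
    then have "x = scale c ?X"
      by (simp add: add_eq_0_iff2)
    then show "x \<in> range (\<lambda>c. scale c ?X)"
      by blast
  qed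
qed

subsection \<open>Transfers around a clique\<close>

lemma cell_antimono:
  "x \<in> cell r' s' t' \<Longrightarrow> r \<le> r' \<Longrightarrow> s \<le> s' \<Longrightarrow> t \<le> t' \<Longrightarrow> x \<in> cell r s t"
  by (auto simp: cell_def)

text \<open>Raising one index adds one linear condition; this exhibits a line of a black 3-clique as
  a kernel in the plane of the clique.\<close>

lemma cell_Suc_s: "cell r (Suc s) t = {x \<in> cell r s t. uc s x = 0}"
  by (auto simp: cell_def less_Suc_eq)

lemma cell_Suc_t: "cell r s (Suc t) = {x \<in> cell r s t. vc t x = 0}"
  by (auto simp: cell_def less_Suc_eq)

text \<open>For \<open>r < d\<close> the truncated bound \<open>d - r\<close> drops by exactly one,
  so the only new condition is on coordinate \<open>d - r\<close>.\<close>

lemma cell_Suc_r: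
  assumes "r < d"
  shows "cell (Suc r) s t = {x \<in> cell r s t. vc (d - r) x = 0}"
proof -
  have "d - Suc r < j \<longleftrightarrow> d - r < j \<or> j = d - r" for j
    using assms by auto
  then have "(\<forall>j\<le>d. d - Suc r < j \<longrightarrow> vc j x = 0) \<longleftrightarrow>
      (\<forall>j\<le>d. d - r < j \<longrightarrow> vc j x = 0) \<and> vc (d - r) x = 0" for x
    by (metis diff_le_self)
  then show ?thesis
    by (auto simp: cell_def)
qed

lemma cell_vector_in_cell: "r + s + t = d \<Longrightarrow> cell_vector s t \<in> cell r s t"
  using cell_eq_line[of r s t] by (metis rangeI scale_one)

text \<open>The vectors \<open>x\<close>, \<open>y\<close> span two lines of a black 3-clique in the plane \<open>cell r s t\<close>, and \<open>f\<close> cuts out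
  the third line.\<close>

lemma transfer_kernel:
  assumes "B l = range (\<lambda>c. scale c x)" "B l' = range (\<lambda>c. scale c y)"
    and "B (completion d l l') = {z \<in> cell r s t. f z = 0}"
    and "x \<in> cell r s t" "y \<in> cell r s t"
    and f: "f \<in> range uc \<union> range vc" and "f x \<noteq> 0" "f y \<noteq> 0"
  shows "transfer scale d B l l' (scale c x) = scale (c * - (f x / f y)) y"
proof -
  have f: "f (z + w) = f z + f w" "f (scale a z) = a * f z" for z w a
    using f by (auto simp: coord_simps)
  \<comment> \<open>The coefficient makes \<open>f\<close> vanish on this vector of the plane, which
    puts it on the third line.\<close>
  moreover have "x + scale (- (f x / f y)) y \<in> B (completion d l l')"
    using assms(3-5,8) cell_combination[of x r s t y] by (simp add: f del: scale_minus_left)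
  ultimately show ?thesis
    using assms by (intro transfer_scale) auto
qed

lemma array_of_int_eq_cell:
  assumes "r + s + t = d" "l = (int r, int s, int t)"
  shows "array_of scale d u v l = cell r s t"
  using array_of_eq_cell[of "int r" "int s" "int t"] assms by simp

lemma B_value_eq:
  assumes "r + s + t + 2 = d"
  shows "B_value scale d (array_of scale d u v) (int r, int s, int t) =
    (det (block T (t + 1) s) * det (block T t (s + 2)) * det (block T (t + 2) (s + 1))) /
    (det (block T (t + 1) (s + 2)) * det (block T (t + 2) s) * det (block T t (s + 1)))"
    (is "_ = ?N / ?D")
proof -
  let ?B = "array_of scale d u v"
  let ?l1 = "(int r, int s + 1, int t + 1)" and ?l2 = "(int r + 1, int s, int t + 1)"
    and ?l3 = "(int r + 1, int s + 1, int t)"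
  define X1 X2 X3 where "X1 = cell_vector (s + 1) (t + 1)" and "X2 = cell_vector s (t + 1)"
    and "X3 = cell_vector (s + 1) t"
  have nz: "det (block T i n) \<noteq> 0" if "i + n \<le> d + 1" for i n
    using very_good_det_block[OF very_good that] .
  have lines: "?B ?l1 = range (\<lambda>c. scale c X1)" "?B ?l2 = range (\<lambda>c. scale c X2)"
    "?B ?l3 = range (\<lambda>c. scale c X3)"
    unfolding X1_def X2_def X3_def using assms
    by (subst array_of_int_eq_cell[of r "s + 1" "t + 1"] array_of_int_eq_cell[of "r + 1" s "t + 1"]
        array_of_int_eq_cell[of "r + 1" "s + 1" t]; simp add: cell_eq_line)+
  have X: "X1 \<in> cell r (s + 1) (t + 1)" "X2 \<in> cell (r + 1) s (t + 1)" "X3 \<in> cell (r + 1) (s + 1) t"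
    unfolding X1_def X2_def X3_def by (rule cell_vector_in_cell; use assms in simp)+
  have t1: "transfer scale d ?B ?l1 ?l2 (scale c X1) =
      scale (c * - (vc (t + 1) X1 / vc (t + 1) X2)) X2" for c
  proof (rule transfer_kernel[where r = r and s = s and t = "t + 1"])
    \<comment> \<open>The third vertex raises \<open>t\<close>, so the functional is the lowest
      \<open>v\<close>-coordinate left in the plane.\<close>
    have "completion d ?l1 ?l2 = (int r, int s, int t + 1 + 1)"
      using assms by (intro completion_clique) auto
    then show "?B (completion d ?l1 ?l2) = {z \<in> cell r s (t + 1). vc (t + 1) z = 0}"
      using assms array_of_int_eq_cell[of r s "Suc (t + 1)"] cell_Suc_t[of r s "t + 1"] by simp
    show "X1 \<in> cell r s (t + 1)" "X2 \<in> cell r s (t + 1)"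
      using X[THEN cell_antimono] by simp_all
    show "vc (t + 1) X1 \<noteq> 0" "vc (t + 1) X2 \<noteq> 0"
      unfolding X1_def X2_def using assms nz by (simp_all add: vc_first_cell_vector)
  qed (use lines in auto)
  have t2: "transfer scale d ?B ?l2 ?l3 (scale c X2) =
      scale (c * - (vc (s + t + 1) X2 / vc (s + t + 1) X3)) X3" for c
  proof (rule transfer_kernel[where r = "r + 1" and s = s and t = t])
    \<comment> \<open>Now \<open>r\<close> is raised, and the functional is the highest
      \<open>v\<close>-coordinate left in the plane.\<close>
    have "completion d ?l2 ?l3 = (int r + 1 + 1, int s, int t)"
      using assms by (intro completion_clique) auto
    moreover have "d - (r + 1) = s + t + 1"
      using assms by simp
    ultimately show "?B (completion d ?l2 ?l3) = {z \<in> cell (r + 1) s t. vc (s + t + 1) z = 0}"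
      using assms array_of_int_eq_cell[of "Suc (r + 1)" s t] cell_Suc_r[of "r + 1" s t] by simp
    show "X2 \<in> cell (r + 1) s t" "X3 \<in> cell (r + 1) s t"
      using X[THEN cell_antimono] by simp_all
    show "vc (s + t + 1) X2 \<noteq> 0" "vc (s + t + 1) X3 \<noteq> 0"
      unfolding X2_def X3_def
      using assms nz vc_last_cell_vector[of s "t + 1"] vc_last_cell_vector[of "s + 1" t] by simp_all
  qed (use lines in auto)
  have t3: "transfer scale d ?B ?l3 ?l1 (scale c X3) =
      scale (c * - (uc (s + 1) X3 / uc (s + 1) X1)) X1" for c
  proof (rule transfer_kernel[where r = r and s = "s + 1" and t = t])
    \<comment> \<open>Here \<open>s\<close> is raised, and the functional is a
      \<open>u\<close>-coordinate.\<close>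
    have "completion d ?l3 ?l1 = (int r, int s + 1 + 1, int t)"
      using assms by (intro completion_clique) auto
    then show "?B (completion d ?l3 ?l1) = {z \<in> cell r (s + 1) t. uc (s + 1) z = 0}"
      using assms array_of_int_eq_cell[of r "Suc (s + 1)" t] cell_Suc_s[of r "s + 1" t] by simp
    show "X3 \<in> cell r (s + 1) t" "X1 \<in> cell r (s + 1) t"
      using X[THEN cell_antimono] by simp_all
    show "uc (s + 1) X3 \<noteq> 0" "uc (s + 1) X1 \<noteq> 0"
      unfolding X1_def X3_def using assms nz by (simp_all add: uc_cell_vector)
  qed (use lines in auto)
  define k where "k = - (vc (t + 1) X1 / vc (t + 1) X2) * - (vc (s + t + 1) X2 / vc (s + t + 1) X3)
    * - (uc (s + 1) X3 / uc (s + 1) X1)"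
  have coords:
    "vc (t + 1) X1 = (-1) ^ (s + 1) * det (block T (t + 2) (s + 1))"
    "vc (t + 1) X2 = (-1) ^ s * det (block T (t + 2) s)"
    "vc (s + t + 1) X2 = det (block T (t + 1) s)"
    "vc (s + t + 1) X3 = det (block T t (s + 1))"
    "uc (s + 1) X3 = det (block T t (s + 2))"
    "uc (s + 1) X1 = det (block T (t + 1) (s + 2))"
    unfolding X1_def X2_def X3_def
    using assms vc_first_cell_vector[of "s + 1" "t + 1"] vc_first_cell_vector[of s "t + 1"]
      vc_last_cell_vector[of s "t + 1"] vc_last_cell_vector[of "s + 1" t]
    by (simp_all add: uc_cell_vector)
  \<comment> \<open>The three minus signs of the transfers cancel against
    \<open>(-1) ^ (s + 1) / (-1) ^ s = -1\<close>.\<close>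
  have "k = ?N / ?D"
    unfolding k_def coords by (simp add: field_simps)
  have loop: "(transfer scale d ?B ?l3 ?l1 \<circ> transfer scale d ?B ?l2 ?l3
      \<circ> transfer scale d ?B ?l1 ?l2) x = scale k x" if mem: "x \<in> ?B ?l1" for x
  proof -
    obtain c where x: "x = scale c X1"
      using mem unfolding lines(1) by blast
    show ?thesis
      unfolding x o_apply t1 t2 t3 scale_scale k_def by (simp only: mult_ac)
  qed
  \<comment> \<open>A nonzero vector on the line makes the scalar unique, as \<open>THE\<close>
    requires.\<close>
  have "X1 \<noteq> 0"
    using coords(6) nz[of "t + 1" "s + 2"] assms coord_scale[OF basis_u, of "s + 1" 0 0] by auto
  moreover have "X1 \<in> ?B ?l1"
    using lines(1) by (metis rangeI scale_one)
  ultimately have "(THE c. \<forall>x\<in>?B ?l1. (transfer scale d ?B ?l3 ?l1 \<circ> transfer scale d ?B ?l2 ?l3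
      \<circ> transfer scale d ?B ?l1 ?l2) x = scale c x) = k"
    using loop by (intro the_equality) (metis, metis scale_right_imp_eq)
  moreover have "(int r + 1, int s, int t + 1) - alpha = ?l1" "(int r + 1, int s, int t + 1) + beta = ?l3"
    by (simp_all add: alpha_def beta_def)
  ultimately show ?thesis
    using \<open>k = ?N / ?D\<close> by (simp add: Let_def del: array_of.simps)
qed

end

section \<open>From block determinants back to locations\<close>

theorem theorem6p6:
  fixes scale :: "'a::field \<Rightarrow> 'b::ab_group_add \<Rightarrow> 'b"
    and d :: nat
    and T :: "'a mat"
    and u v :: "nat \<Rightarrow> 'b"
    and r s t :: int
    and m :: loc
  assumes "vector_space scale"
    and "d \<ge> 2"
    and "vector_space.dim scale UNIV = d + 1"
    and "very_good d T"
    and "transition_matrix scale d T u v"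
    and "(r, s, t) \<in> triangle (d - 2)"
    and "m = (r + 1, s, t + 1)"
  shows "B_value scale d (array_of scale d u v) (r, s, t) =
    (det (loc_block d T (m + alpha)) * det (loc_block d T (m + beta)) * det (loc_block d T (m + gamma))) /
    (det (loc_block d T (m - alpha)) * det (loc_block d T (m - beta)) * det (loc_block d T (m - gamma)))"
proof -
  interpret vector_space scale
    by (rule assms(1))
  interpret very_good_transition scale d T u v
    by unfold_locales (rule assms(4,5))+
  have rst: "0 \<le> r" "0 \<le> s" "0 \<le> t" "r + s + t + 2 = int d"
    using assms(2,6) by (auto simp: triangle_def)
  then have "nat r + nat s + nat t + 2 = d"
    by linarith
  note B_value_eq[OF this]
  \<comment> \<open>Only \<open>m + alpha\<close> and \<open>m - beta\<close> can leave the
    triangle, namely for \<open>s = 0\<close>; their second index is then -1 and the block is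
    empty.\<close>
  moreover have "m + alpha = (r + 2, s - 1, t + 1)" "m + beta = (r + 1, s + 1, t)"
    "m + gamma = (r, s, t + 2)" "m - alpha = (r, s + 1, t + 1)" "m - beta = (r + 1, s - 1, t + 2)"
    "m - gamma = (r + 2, s, t)"
    by (simp_all add: assms(7) alpha_def beta_def gamma_def)
  ultimately show ?thesis
    using rst by (simp add: det_loc_block[OF assms(4)] nat_add_distrib del: loc_block.simps B_value.simps)
qed

end
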